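(* Let $R$ be a commutative ring with unity and let $M$ be a finitely generated faithful $R$-module with $\operatorname{Spec}(M)\neq\emptyset$. Then $\widetilde{\operatorname{Spec}(M)}$ is a Lindelöf space if and only if $R$ has countably many maximal ideals.
   Context: For a submodule $N$ of an $R$-module $M$, $(N:M)=\{r\in R : rM\subseteq N\}$. A proper submodule $P$ of $M$ is prime if whenever $rm\in P$ with $r\in R$, $m\in M$, then $m\in P$ or $r\in(P:M)$; in this case $(P:M)$ is a prime ideal of $R$. $\operatorname{Spec}(M)$ is the set of all prime submodules of $M$. A subset $T\subseteq R$ is multiplicatively closed if $1\in T$ and $xy\in T$ whenever $x,y\in T$. For a family $\mathcal{S}=\{S_i\}_{i\in I}$ of multiplicatively closed subsets of $R$, $\widetilde{V}(\mathcal{S})=\{P\in\operatorname{Spec}(M) \mid (P:M)\cap S_i\neq\emptyset \text{ for all } i\in I\}$. $\widetilde{\operatorname{Spec}(M)}$ denotes the set $\operatorname{Spec}(M)$ with the topology whose closed sets are exactly the sets $\widetilde{V}(\mathcal{S})$, $\mathcal{S}$ ranging over all families of multiplicatively closed subsets of $R$. A topological space is Lindelöf if every open cover has a countable subcover. "Countably many" means finitely many or countably infinitely many. *)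

theory Defs
  imports "HOL-Analysis.Lindelof_Spaces" "HOL-Algebra.Module" "HOL-Algebra.Ideal"
begin

(* The qualified name Module.module is needed because HOL.Modules also has a locale "module". *)

definition colon :: "('a, 'm) ring_scheme \<Rightarrow> ('a, 'b, 'n) module_scheme \<Rightarrow> 'b set \<Rightarrow> 'a set" where
  "colon R M N = {r \<in> carrier R. \<forall>m \<in> carrier M. r \<odot>\<^bsub>M\<^esub> m \<in> N}"

definition prime_submodule :: "('a, 'm) ring_scheme \<Rightarrow> ('a, 'b, 'n) module_scheme \<Rightarrow> 'b set \<Rightarrow> bool" where
  "prime_submodule R M P \<longleftrightarrow>
     submodule P R M \<and> P \<noteq> carrier M \<and>
     (\<forall>r \<in> carrier R. \<forall>m \<in> carrier M. r \<odot>\<^bsub>M\<^esub> m \<in> P \<longrightarrow> m \<in> P \<or> r \<in> colon R M P)"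

definition mod_Spec :: "('a, 'm) ring_scheme \<Rightarrow> ('a, 'b, 'n) module_scheme \<Rightarrow> 'b set set" where
  "mod_Spec R M = {P. prime_submodule R M P}"

definition finitely_generated_module :: "('a, 'm) ring_scheme \<Rightarrow> ('a, 'b, 'n) module_scheme \<Rightarrow> bool" where
  "finitely_generated_module R M \<longleftrightarrow>
     (\<exists>A. finite A \<and> A \<subseteq> carrier M \<and>
          carrier M = {\<Oplus>\<^bsub>M\<^esub>a\<in>A. c a \<odot>\<^bsub>M\<^esub> a | c. c \<in> A \<rightarrow> carrier R})"

definition faithful_module :: "('a, 'm) ring_scheme \<Rightarrow> ('a, 'b, 'n) module_scheme \<Rightarrow> bool" where
  "faithful_module R M \<longleftrightarrow>
     {r \<in> carrier R. \<forall>m \<in> carrier M. r \<odot>\<^bsub>M\<^esub> m = \<zero>\<^bsub>M\<^esub>} = {\<zero>\<^bsub>R\<^esub>}"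

(* A family (S_i) enters only through its set of members, so families are rendered as
   sets of subsets of the ring. *)
definition V_tilde ::
    "('a, 'm) ring_scheme \<Rightarrow> ('a, 'b, 'n) module_scheme \<Rightarrow> 'a set set \<Rightarrow> 'b set set" where
  "V_tilde R M \<S> = {P \<in> mod_Spec R M. \<forall>S \<in> \<S>. colon R M P \<inter> S \<noteq> {}}"

(* The library predicate "submonoid S R" says exactly that S is a multiplicatively closed
   subset of R containing 1. *)
definition Spec_tilde :: "('a, 'm) ring_scheme \<Rightarrow> ('a, 'b, 'n) module_scheme \<Rightarrow> 'b set topology" where
  "Spec_tilde R M = topology (\<lambda>U. U \<subseteq> mod_Spec R M \<and>
     (\<exists>\<S>. (\<forall>S \<in> \<S>. submonoid S R) \<and> mod_Spec R M - U = V_tilde R M \<S>))"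

lemma submonoid_compl_colon:
  assumes "Module.module R M" and P: "P \<in> mod_Spec R M"
  shows "submonoid (carrier R - colon R M P) R"
proof -
  interpret Module.module R M by fact
  have sub: "submodule P R M" and ne: "P \<noteq> carrier M"
    and pr: "\<And>r m. \<lbrakk>r \<in> carrier R; m \<in> carrier M; r \<odot>\<^bsub>M\<^esub> m \<in> P\<rbrakk> \<Longrightarrow> m \<in> P \<or> r \<in> colon R M P"
    using P by (auto simp: mod_Spec_def prime_submodule_def)
  have PM: "P \<subseteq> carrier M" using submoduleE(1)[OF sub] .
  show ?thesis
  proof
    show "carrier R - colon R M P \<subseteq> carrier R" by blast
    show "\<one>\<^bsub>R\<^esub> \<in> carrier R - colon R M P"
      using PM ne by (auto simp: colon_def)
    fix x y assume x: "x \<in> carrier R - colon R M P" and y: "y \<in> carrier R - colon R M P"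
    then obtain m where m: "m \<in> carrier M" "y \<odot>\<^bsub>M\<^esub> m \<notin> P" by (auto simp: colon_def)
    have "x \<odot>\<^bsub>M\<^esub> (y \<odot>\<^bsub>M\<^esub> m) \<notin> P" using pr[of x "y \<odot>\<^bsub>M\<^esub> m"] x y m by auto
    then have "(x \<otimes>\<^bsub>R\<^esub> y) \<odot>\<^bsub>M\<^esub> m \<notin> P" using x y m by (simp add: smult_assoc1)
    then show "x \<otimes>\<^bsub>R\<^esub> y \<in> carrier R - colon R M P"
      using x y m by (auto simp: colon_def)
  qed
qed

lemma istopology_Spec_tilde:
  assumes "Module.module R M"
  shows "istopology (\<lambda>U. U \<subseteq> mod_Spec R M \<and>
     (\<exists>\<S>. (\<forall>S \<in> \<S>. submonoid S R) \<and> mod_Spec R M - U = V_tilde R M \<S>))"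
    (is "istopology ?L")
  unfolding istopology_def
proof (intro conjI allI impI)
  fix U W assume U: "?L U" and W: "?L W"
  define \<S> where "\<S> = (\<lambda>Q. carrier R - colon R M Q) ` (U \<inter> W)"
  obtain \<A> \<B> where AB: "mod_Spec R M - U = V_tilde R M \<A>" "mod_Spec R M - W = V_tilde R M \<B>"
    using U W by blast
  have mono: "Q \<in> V_tilde R M \<C>"
    if "P \<in> V_tilde R M \<C>" "Q \<in> mod_Spec R M" "colon R M P \<subseteq> colon R M Q" for P Q \<C>
    using that by (auto simp: V_tilde_def)
  have iff: "P \<in> V_tilde R M \<S> \<longleftrightarrow>
      P \<in> mod_Spec R M \<and> (\<forall>Q \<in> U \<inter> W. \<not> colon R M P \<subseteq> colon R M Q)" for P
    by (auto simp: V_tilde_def \<S>_def colon_def)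
  have "mod_Spec R M - (U \<inter> W) = V_tilde R M \<S>"
  proof (rule Set.set_eqI)
    fix P
    show "P \<in> mod_Spec R M - (U \<inter> W) \<longleftrightarrow> P \<in> V_tilde R M \<S>"
    proof
      assume P: "P \<in> mod_Spec R M - (U \<inter> W)"
      have "\<not> colon R M P \<subseteq> colon R M Q" if Q: "Q \<in> U \<inter> W" for Q
      proof
        assume le: "colon R M P \<subseteq> colon R M Q"
        have "Q \<in> mod_Spec R M" using Q U by blast
        moreover have "P \<in> V_tilde R M \<A> \<or> P \<in> V_tilde R M \<B>" using P AB by blast
        ultimately have "Q \<in> V_tilde R M \<A> \<or> Q \<in> V_tilde R M \<B>" using mono le by blast
        then show False using Q AB by blast
      qed
      then show "P \<in> V_tilde R M \<S>" using P iff by blast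
    next
      assume "P \<in> V_tilde R M \<S>"
      then show "P \<in> mod_Spec R M - (U \<inter> W)" using iff by blast
    qed
  qed
  moreover have "\<forall>S \<in> \<S>. submonoid S R"
    using U submonoid_compl_colon[OF assms] by (auto simp: \<S>_def)
  ultimately show "\<exists>\<S>. (\<forall>S \<in> \<S>. submonoid S R) \<and> mod_Spec R M - (U \<inter> W) = V_tilde R M \<S>"
    by blast
  show "U \<inter> W \<subseteq> mod_Spec R M" using U by blast
next
  fix \<K> assume K: "\<forall>K\<in>\<K>. ?L K"
  then show "\<Union>\<K> \<subseteq> mod_Spec R M" by blast
  from K have "\<forall>K\<in>\<K>. \<exists>\<S>. (\<forall>S \<in> \<S>. submonoid S R) \<and> mod_Spec R M - K = V_tilde R M \<S>"
    by blast
  then obtain F where F: "\<And>K S. \<lbrakk>K \<in> \<K>; S \<in> F K\<rbrakk> \<Longrightarrow> submonoid S R"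
    "\<And>K. K \<in> \<K> \<Longrightarrow> mod_Spec R M - K = V_tilde R M (F K)"
    by metis
  have "mod_Spec R M - \<Union>\<K> = {P \<in> mod_Spec R M. \<forall>K\<in>\<K>. P \<in> mod_Spec R M - K}" by blast
  also have "\<dots> = {P \<in> mod_Spec R M. \<forall>K\<in>\<K>. P \<in> V_tilde R M (F K)}" using F(2) by auto
  also have "\<dots> = V_tilde R M (\<Union>(F ` \<K>))" by (auto simp: V_tilde_def)
  finally show "\<exists>\<S>. (\<forall>S \<in> \<S>. submonoid S R) \<and> mod_Spec R M - \<Union>\<K> = V_tilde R M \<S>"
    using F(1) by (intro exI[of _ "\<Union>(F ` \<K>)"]) auto
qed

lemma openin_Spec_tilde:
  assumes "Module.module R M"
  shows "openin (Spec_tilde R M) U \<longleftrightarrow> U \<subseteq> mod_Spec R M \<and>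
     (\<exists>\<S>. (\<forall>S \<in> \<S>. submonoid S R) \<and> mod_Spec R M - U = V_tilde R M \<S>)"
  unfolding Spec_tilde_def using topology_inverse'[OF istopology_Spec_tilde[OF assms]] by simp

lemma topspace_Spec_tilde:
  assumes "Module.module R M"
  shows "topspace (Spec_tilde R M) = mod_Spec R M"
proof
  show "topspace (Spec_tilde R M) \<subseteq> mod_Spec R M"
    using openin_topspace openin_Spec_tilde[OF assms] by blast
  have "V_tilde R M {{\<one>\<^bsub>R\<^esub>}} = {}"
  proof -
    interpret Module.module R M by fact
    show ?thesis
      by (auto simp: V_tilde_def mod_Spec_def prime_submodule_def colon_def
          dest: submoduleE(1))
  qed
  moreover have "submonoid {\<one>\<^bsub>R\<^esub>} R"
  proof -
    interpret Module.module R M by fact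
    show ?thesis by unfold_locales auto
  qed
  ultimately have "openin (Spec_tilde R M) (mod_Spec R M)"
    unfolding openin_Spec_tilde[OF assms] by (auto intro!: exI[of _ "{{\<one>\<^bsub>R\<^esub>}}"])
  then show "mod_Spec R M \<subseteq> topspace (Spec_tilde R M)" by (rule openin_subset)
qed

lemma closedin_Spec_tilde:
  assumes "Module.module R M"
  shows "closedin (Spec_tilde R M) C \<longleftrightarrow>
     (\<exists>\<S>. (\<forall>S \<in> \<S>. submonoid S R) \<and> C = V_tilde R M \<S>)"
proof -
  have "V_tilde R M \<S> \<subseteq> mod_Spec R M" for \<S> by (auto simp: V_tilde_def)
  then show ?thesis
    unfolding closedin_def topspace_Spec_tilde[OF assms] openin_Spec_tilde[OF assms]
    by (auto simp: double_diff)
qed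

end

theory Submission
  imports Defs "HOL-Algebra.Ring_Divisibility"
begin

text \<open>
  A set of prime submodules is open iff it is closed under passing to smaller colon ideals, so
  the smallest neighbourhood of \<open>P\<close> consists of all \<open>Q\<close> with \<open>(Q:M) \<subseteq> (P:M)\<close>. For a maximal ideal
  \<open>I\<close>, Nakayama's argument gives \<open>IM \<noteq> M\<close>, hence \<open>IM\<close> is a prime submodule with colon ideal \<open>I\<close>.
  The smallest neighbourhoods of the points \<open>IM\<close> cover the space, and each of them contains
  only one such point, so no proper subfamily is a cover. Thus countable
  subcovers exist exactly if there are countably many maximal ideals.
\<close>

section \<open>Ideals\<close>

text \<open>Zorn's lemma on the ideals that contain \<open>J\<close> and miss \<open>\<one>\<close>.
  Properness expressed as missing \<open>\<one>\<close> passes directly to unions of chains.\<close>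

lemma (in cring) exists_maximalideal_above:
  assumes "ideal J R" and "\<one> \<notin> J"
  obtains I where "maximalideal I R" and "J \<subseteq> I"
proof -
  define \<A> where "\<A> = {K. ideal K R \<and> J \<subseteq> K \<and> \<one> \<notin> K}"
  have "\<exists>I\<in>\<A>. \<forall>K\<in>\<A>. I \<subseteq> K \<longrightarrow> K = I"
  proof (rule subset_Zorn_nonempty)
    show "\<A> \<noteq> {}" using assms by (auto simp: \<A>_def)
    fix \<C> assume ne: "\<C> \<noteq> {}" and chain: "subset.chain \<A> \<C>"
    have "subset.chain {K. ideal K R} \<C>"
      using chain by (auto simp: subset_chain_def \<A>_def)
    then have "ideal (\<Union>\<C>) R" using chain_Union_is_ideal[of \<C>] ne by simp
    then show "\<Union>\<C> \<in> \<A>" using ne chain by (auto simp: \<A>_def subset_chain_def)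
  qed
  then obtain I where I: "ideal I R" "J \<subseteq> I" "\<one> \<notin> I"
    and max: "\<And>K. \<lbrakk>ideal K R; J \<subseteq> K; \<one> \<notin> K; I \<subseteq> K\<rbrakk> \<Longrightarrow> K = I"
    by (auto simp: \<A>_def)
  have "maximalideal I R"
  proof (rule maximalidealI)
    show "carrier R \<noteq> I" using I(3) by auto
    fix K assume K: "ideal K R" "I \<subseteq> K" "K \<subseteq> carrier R"
    then show "K = I \<or> K = carrier R"
      using max[OF K(1)] I(2) ideal.one_imp_carrier[OF K(1)] by blast
  qed (rule I(1))
  then show thesis using I(2) that by blast
qed

lemma (in maximalideal) eq_if_subset_proper:
  assumes "ideal J R" and "I \<subseteq> J" and "\<one> \<notin> J"
  shows "J = I"
  using I_maximal[OF assms(1,2)] ideal.Icarr[OF assms(1)] assms(3) one_closed by blast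

lemma (in primeideal) submonoid_compl: "submonoid (carrier R - I) R"
  using I_prime I_notcarr one_imp_carrier by unfold_locales auto

section \<open>The submodule generated by products\<close>

text \<open>For an ideal \<open>I\<close> and \<open>G = carrier M\<close> this is the submodule IM;
  for \<open>I = carrier R\<close> it is the ordinary span of \<open>G\<close>. Adding one product
  at a time gives induction over finite sums without index sets.\<close>

inductive_set prod_span ::
    "('a, 'm) ring_scheme \<Rightarrow> ('a, 'b, 'n) module_scheme \<Rightarrow> 'a set \<Rightarrow> 'b set \<Rightarrow> 'b set"
  for R M I G where
  zero: "\<zero>\<^bsub>M\<^esub> \<in> prod_span R M I G"
| add: "\<lbrakk>i \<in> I; g \<in> G; x \<in> prod_span R M I G\<rbrakk> \<Longrightarrow> i \<odot>\<^bsub>M\<^esub> g \<oplus>\<^bsub>M\<^esub> x \<in> prod_span R M I G"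

context Module.module
begin

text \<open>Taking \<open>X = carrier M\<close> yields the colon ideal of \<open>N\<close>; taking
  \<open>X = {m}\<close> yields the ideal that tests primeness of \<open>N\<close> at
  \<open>m\<close>.\<close>

lemma ideal_transporter:
  assumes N: "submodule N R M" and X: "X \<subseteq> carrier M"
  shows "ideal {r \<in> carrier R. \<forall>x\<in>X. r \<odot>\<^bsub>M\<^esub> x \<in> N} R" (is "ideal ?J R")
proof -
  note NE = submoduleE[OF N]
  have X': "x \<in> carrier M" if "x \<in> X" for x using X that by blast
  have zero: "\<zero>\<^bsub>M\<^esub> \<in> N"
  proof -
    obtain x where "x \<in> N" using NE(2) by blast
    then show ?thesis using NE(1) NE(4)[of \<zero> x] by auto
  qed
  show ?thesis
  proof (rule idealI)
    show "subgroup ?J (add_monoid R)"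
    proof (rule R.add.subgroupI)
      show "?J \<noteq> {}" using zero X' by (auto intro!: exI[of _ \<zero>])
    qed (use NE X' in \<open>auto simp: smult_l_distr smult_l_minus simp flip: a_inv_def\<close>)
    fix a r assume ar: "a \<in> ?J" "r \<in> carrier R"
    then show "r \<otimes> a \<in> ?J" using NE X' by (auto simp: smult_assoc1)
    then show "a \<otimes> r \<in> ?J" using ar by (simp add: R.m_comm)
  qed (rule R.ring_axioms)
qed

lemma ideal_colon:
  assumes "submodule N R M"
  shows "ideal (colon R M N) R"
  unfolding colon_def using ideal_transporter[OF assms] by simp

lemma one_notin_colon:
  assumes "submodule N R M" and "N \<noteq> carrier M"
  shows "\<one> \<notin> colon R M N"
  using submoduleE(1)[OF assms(1)] assms(2) by (auto simp: colon_def)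

lemma prod_span_carrier:
  assumes "I \<subseteq> carrier R" and "G \<subseteq> carrier M" and "x \<in> prod_span R M I G"
  shows "x \<in> carrier M"
  using assms(3,1,2) by induction auto

lemma prod_span_base:
  assumes "i \<in> I" and "g \<in> G" and "I \<subseteq> carrier R" and "G \<subseteq> carrier M"
  shows "i \<odot>\<^bsub>M\<^esub> g \<in> prod_span R M I G"
proof -
  have "i \<odot>\<^bsub>M\<^esub> g \<oplus>\<^bsub>M\<^esub> \<zero>\<^bsub>M\<^esub> \<in> prod_span R M I G"
    using assms by (intro prod_span.intros)
  moreover have "i \<odot>\<^bsub>M\<^esub> g \<in> carrier M" using assms by blast
  ultimately show ?thesis by simp
qed

lemma prod_span_add:
  assumes "I \<subseteq> carrier R" and "G \<subseteq> carrier M"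
    and "x \<in> prod_span R M I G" and y: "y \<in> prod_span R M I G"
  shows "x \<oplus>\<^bsub>M\<^esub> y \<in> prod_span R M I G"
  using assms(3)
proof induction
  case zero
  then show ?case using y prod_span_carrier[OF assms(1,2)] by simp
next
  case (add i g x)
  have "i \<odot>\<^bsub>M\<^esub> g \<in> carrier M" "x \<in> carrier M" "y \<in> carrier M"
    using add y prod_span_carrier[OF assms(1,2)] assms by blast+
  then show ?case using add by (auto simp: M.a_assoc intro: prod_span.add)
qed

text \<open>The separate target \<open>J\<close> covers three uses: closure of the span under
  scalars (\<open>J = I\<close>), multiplication of a full span by an element of an ideal
  \<open>J\<close>, and, with \<open>r = \<one>\<close>, monotonicity in the coefficients.\<close>

lemma smult_prod_span:
  assumes "I \<subseteq> carrier R" and "G \<subseteq> carrier M" and "r \<in> carrier R"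
    and "\<And>i. i \<in> I \<Longrightarrow> r \<otimes> i \<in> J" and "x \<in> prod_span R M I G"
  shows "r \<odot>\<^bsub>M\<^esub> x \<in> prod_span R M J G"
  using assms(5)
proof induction
  case zero
  then show ?case using assms(3) by (simp add: prod_span.zero)
next
  case (add i g x)
  have c: "i \<in> carrier R" "g \<in> carrier M" "x \<in> carrier M"
    using add prod_span_carrier[OF assms(1,2)] assms by blast+
  have "(r \<otimes> i) \<odot>\<^bsub>M\<^esub> g \<oplus>\<^bsub>M\<^esub> r \<odot>\<^bsub>M\<^esub> x \<in> prod_span R M J G"
    using add assms(4) by (intro prod_span.add)
  then show ?case using c assms(3) by (simp add: smult_r_distr smult_assoc1)
qed

lemma submodule_prod_span:
  assumes "ideal I R" and G: "G \<subseteq> carrier M"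
  shows "submodule (prod_span R M I G) R M"
proof -
  interpret ideal I R by fact
  note I = a_subset
  have smult: "r \<odot>\<^bsub>M\<^esub> x \<in> prod_span R M I G"
    if "r \<in> carrier R" "x \<in> prod_span R M I G" for r x
    using smult_prod_span[OF I G that(1) _ that(2)] I_l_closed that(1) by blast
  show ?thesis
  proof (rule submoduleI)
    show "prod_span R M I G \<subseteq> carrier M" using prod_span_carrier[OF I G] by blast
    show "\<ominus>\<^bsub>M\<^esub> x \<in> prod_span R M I G" if "x \<in> prod_span R M I G" for x
    proof -
      have "\<ominus>\<^bsub>M\<^esub> x = (\<ominus> \<one>) \<odot>\<^bsub>M\<^esub> x"
        using prod_span_carrier[OF I G that] by (simp add: smult_l_minus)
      then show ?thesis using smult[of "\<ominus> \<one>"] that by simp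
    qed
  qed (auto intro: prod_span.zero prod_span_add[OF I G] smult)
qed

lemma prod_span_empty: "prod_span R M I {} = {\<zero>\<^bsub>M\<^esub>}"
  by (auto elim: prod_span.cases intro: prod_span.zero)

text \<open>Since an ideal is closed under addition, all products with \<open>x\<close> merge into
  one coefficient. This isolates the generator that is to be eliminated.\<close>

lemma prod_span_insertE:
  assumes "ideal I R" and x: "x \<in> carrier M" and B: "B \<subseteq> carrier M"
    and "y \<in> prod_span R M I (insert x B)"
  obtains i b where "i \<in> I" and "b \<in> prod_span R M I B" and "y = i \<odot>\<^bsub>M\<^esub> x \<oplus>\<^bsub>M\<^esub> b"
proof -
  interpret ideal I R by fact
  note I = a_subset
  from assms(4) have "\<exists>i\<in>I. \<exists>b\<in>prod_span R M I B. y = i \<odot>\<^bsub>M\<^esub> x \<oplus>\<^bsub>M\<^esub> b"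
  proof induction
    case zero
    show ?case using x
      by (intro bexI[of _ "\<zero>"] bexI[of _ "\<zero>\<^bsub>M\<^esub>"]) (auto intro: prod_span.zero)
  next
    case (add j g z)
    then obtain i b where ib: "i \<in> I" "b \<in> prod_span R M I B" "z = i \<odot>\<^bsub>M\<^esub> x \<oplus>\<^bsub>M\<^esub> b" by blast
    have c: "i \<in> carrier R" "j \<in> carrier R" "g \<in> carrier M" "b \<in> carrier M"
      using ib add I x B prod_span_carrier[OF I B] by auto
    consider "g = x" | "g \<in> B" using add by blast
    then show ?case
    proof cases
      case 1
      have "j \<odot>\<^bsub>M\<^esub> g \<oplus>\<^bsub>M\<^esub> z = (j \<oplus> i) \<odot>\<^bsub>M\<^esub> x \<oplus>\<^bsub>M\<^esub> b"
        using c x 1 ib(3) by (simp add: smult_l_distr M.a_assoc)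
      then show ?thesis using ib add by blast
    next
      case 2
      have "j \<odot>\<^bsub>M\<^esub> g \<oplus>\<^bsub>M\<^esub> z = i \<odot>\<^bsub>M\<^esub> x \<oplus>\<^bsub>M\<^esub> (j \<odot>\<^bsub>M\<^esub> g \<oplus>\<^bsub>M\<^esub> b)"
        using c x ib(3) by (simp add: M.a_lcomm)
      then show ?thesis using ib add 2 by (blast intro: prod_span.add)
    qed
  qed
  then show thesis using that by blast
qed

section \<open>Nakayama's argument by elimination of generators\<close>

lemma finitely_generated_prod_span:
  assumes "finitely_generated_module R M"
  obtains A where "finite A" and "A \<subseteq> carrier M" and "carrier M = prod_span R M (carrier R) A"
proof -
  obtain A where A: "finite A" "A \<subseteq> carrier M"
    and gen: "carrier M = {\<Oplus>\<^bsub>M\<^esub>a\<in>A. c a \<odot>\<^bsub>M\<^esub> a | c. c \<in> A \<rightarrow> carrier R}"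
    using assms unfolding finitely_generated_module_def by blast
  have "(\<Oplus>\<^bsub>M\<^esub>a\<in>F. c a \<odot>\<^bsub>M\<^esub> a) \<in> prod_span R M (carrier R) A"
    if "finite F" "F \<subseteq> A" "c \<in> A \<rightarrow> carrier R" for c F
    using that
  proof (induction F rule: finite_induct)
    case empty
    then show ?case by (simp add: prod_span.zero)
  next
    case (insert x F)
    have "(\<lambda>a. c a \<odot>\<^bsub>M\<^esub> a) \<in> F \<rightarrow> carrier M" "c x \<odot>\<^bsub>M\<^esub> x \<in> carrier M"
      using insert.prems A(2) by (auto simp: Pi_iff subset_iff)
    then have "(\<Oplus>\<^bsub>M\<^esub>a\<in>insert x F. c a \<odot>\<^bsub>M\<^esub> a) = c x \<odot>\<^bsub>M\<^esub> x \<oplus>\<^bsub>M\<^esub> (\<Oplus>\<^bsub>M\<^esub>a\<in>F. c a \<odot>\<^bsub>M\<^esub> a)"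
      using insert.hyps by (simp add: M.finsum_insert)
    then show ?case using insert by (auto intro: prod_span.add)
  qed
  then have "carrier M \<subseteq> prod_span R M (carrier R) A" using gen A(1) by auto
  then have "carrier M = prod_span R M (carrier R) A"
    using prod_span_carrier[OF subset_refl A(2)] by blast
  then show thesis using A that by blast
qed

text \<open>
  Elimination of generators: if \<open>sM\<close> lies in the span of \<open>B \<union> {x}\<close>, then \<open>sM = s(IM) = I(sM)\<close> shows
  \<open>sx = ix + b\<close> with \<open>i \<in> I\<close> and \<open>b\<close> in the span of \<open>B\<close>, so \<open>(s - i)sM\<close> lies in the span of \<open>B\<close>.
  Primeness of \<open>I\<close> keeps the multiplier outside \<open>I\<close>.
\<close>
lemma annihilator_outside_primeideal:
  assumes "primeideal I R" and IM: "prod_span R M I (carrier M) = carrier M"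
    and "finite B" and "B \<subseteq> carrier M" and "s \<in> carrier R - I"
    and "\<And>m. m \<in> carrier M \<Longrightarrow> s \<odot>\<^bsub>M\<^esub> m \<in> prod_span R M (carrier R) B"
  shows "\<exists>t\<in>carrier R - I. \<forall>m\<in>carrier M. t \<odot>\<^bsub>M\<^esub> m = \<zero>\<^bsub>M\<^esub>"
  using assms(3-)
proof (induction B arbitrary: s rule: finite_induct)
  case empty
  \<comment> \<open>With no generators left the span is zero, so \<open>s\<close> itself annihilates
    \<open>M\<close>.\<close>
  then show ?case by (auto simp: prod_span_empty)
next
  case (insert x B)
  interpret primeideal I R by fact
  note I = a_subset
  have s: "s \<in> carrier R" "s \<notin> I" and x: "x \<in> carrier M" and B: "B \<subseteq> carrier M"
    using insert.prems by auto
  \<comment> \<open>Write \<open>m\<close> as a sum of products \<open>i g\<close> with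
    \<open>i\<close> in \<open>I\<close>. Moving \<open>s\<close> past \<open>i\<close> leaves
    \<open>i\<close> times \<open>s g\<close>, and \<open>s g\<close> already lies in the span of
    the generators.\<close>
  have sI: "s \<odot>\<^bsub>M\<^esub> m \<in> prod_span R M I (insert x B)" if "m \<in> carrier M" for m
  proof -
    from that have "m \<in> prod_span R M I (carrier M)" unfolding IM .
    then show ?thesis
    proof induction
      case zero
      then show ?case using s by (simp add: prod_span.zero)
    next
      case (add i g y)
      have c: "i \<in> carrier R" "y \<in> carrier M"
        using add I prod_span_carrier[OF I subset_refl] by auto
      have "i \<odot>\<^bsub>M\<^esub> (s \<odot>\<^bsub>M\<^esub> g) \<in> prod_span R M I (insert x B)"
        using smult_prod_span[OF subset_refl _ c(1), of "insert x B" I] insert.prems(1,3)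
          add(1,2) I_r_closed by blast
      moreover have "s \<odot>\<^bsub>M\<^esub> (i \<odot>\<^bsub>M\<^esub> g \<oplus>\<^bsub>M\<^esub> y) = i \<odot>\<^bsub>M\<^esub> (s \<odot>\<^bsub>M\<^esub> g) \<oplus>\<^bsub>M\<^esub> s \<odot>\<^bsub>M\<^esub> y"
        using c s add by (simp add: smult_r_distr R.m_comm flip: smult_assoc1)
      ultimately show ?case using prod_span_add[OF I insert.prems(1)] add by simp
    qed
  qed
  obtain i b where i: "i \<in> I" and b: "b \<in> prod_span R M I B"
    and sx: "s \<odot>\<^bsub>M\<^esub> x = i \<odot>\<^bsub>M\<^esub> x \<oplus>\<^bsub>M\<^esub> b"
    using prod_span_insertE[OF is_ideal x B sI[OF x]] by blast
  have iR: "i \<in> carrier R" and bM: "b \<in> carrier M"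
    using i I prod_span_carrier[OF I B b] by auto
  define t where "t = s \<ominus> i"
  have t: "t \<in> carrier R" using s iR by (simp add: t_def)
  have "t \<oplus> i = s" using s iR unfolding t_def by algebra
  then have "t \<notin> I" using s(2) i by auto
  then have ts: "t \<otimes> s \<in> carrier R - I" using I_prime[OF t s(1)] s t by auto
  interpret B: submodule "prod_span R M (carrier R) B" R M
    by (rule submodule_prod_span[OF R.oneideal B])
  \<comment> \<open>The inclusion is multiplication by \<open>\<one>\<close>.\<close>
  have "prod_span R M I B \<subseteq> prod_span R M (carrier R) B"
    using smult_prod_span[OF I B R.one_closed] prod_span_carrier[OF I B] I by force
  then have bR: "b \<in> prod_span R M (carrier R) B" using b by blast
  have "t \<odot>\<^bsub>M\<^esub> x = s \<odot>\<^bsub>M\<^esub> x \<ominus>\<^bsub>M\<^esub> i \<odot>\<^bsub>M\<^esub> x"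
    using s iR x by (simp add: t_def smult_l_distr smult_l_minus a_minus_def)
  also have "\<dots> = b"
    unfolding sx using iR x bM by (simp add: a_minus_def M.a_ac M.r_neg M.r_neg1)
  finally have tx: "t \<odot>\<^bsub>M\<^esub> x = b" .
  \<comment> \<open>The factor \<open>s\<close> brings \<open>m\<close> into the span of
    \<open>insert x B\<close>; the factor \<open>t\<close> then replaces the remaining
    \<open>x\<close> by \<open>b\<close>, which lies in the span of \<open>B\<close>.\<close>
  show ?case
  proof (rule insert.IH[OF B ts])
    fix m assume m: "m \<in> carrier M"
    obtain r c where r: "r \<in> carrier R" and c: "c \<in> prod_span R M (carrier R) B"
      and sm: "s \<odot>\<^bsub>M\<^esub> m = r \<odot>\<^bsub>M\<^esub> x \<oplus>\<^bsub>M\<^esub> c"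
      using prod_span_insertE[OF R.oneideal x B insert.prems(3)[OF m]] by blast
    have cM: "c \<in> carrier M" using prod_span_carrier[OF subset_refl B c] .
    have "(t \<otimes> s) \<odot>\<^bsub>M\<^esub> m = t \<odot>\<^bsub>M\<^esub> (r \<odot>\<^bsub>M\<^esub> x \<oplus>\<^bsub>M\<^esub> c)"
      using t s m sm by (simp add: smult_assoc1)
    also have "\<dots> = r \<odot>\<^bsub>M\<^esub> (t \<odot>\<^bsub>M\<^esub> x) \<oplus>\<^bsub>M\<^esub> t \<odot>\<^bsub>M\<^esub> c"
      using t r x cM by (simp add: smult_r_distr R.m_comm flip: smult_assoc1)
    finally show "(t \<otimes> s) \<odot>\<^bsub>M\<^esub> m \<in> prod_span R M (carrier R) B"
      using prod_span_add[OF subset_refl B] B.smult_closed t r c bR tx by simp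
  qed
qed

text \<open>If IM were all of \<open>M\<close>, elimination started with \<open>s = \<one>\<close>
  and a finite generating set would produce an annihilator of \<open>M\<close> outside
  \<open>I\<close>. Faithfulness makes it zero, and zero lies in \<open>I\<close>.\<close>

lemma prod_span_primeideal_neq_carrier:
  assumes "primeideal I R" and "finitely_generated_module R M" and "faithful_module R M"
  shows "prod_span R M I (carrier M) \<noteq> carrier M"
proof
  assume IM: "prod_span R M I (carrier M) = carrier M"
  interpret primeideal I R by fact
  obtain A where A: "finite A" "A \<subseteq> carrier M" "carrier M = prod_span R M (carrier R) A"
    using finitely_generated_prod_span[OF assms(2)] .
  have "\<one> \<in> carrier R - I" using I_notcarr one_imp_carrier by auto
  then obtain t where "t \<in> carrier R - I" "\<forall>m\<in>carrier M. t \<odot>\<^bsub>M\<^esub> m = \<zero>\<^bsub>M\<^esub>"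
    using annihilator_outside_primeideal[OF assms(1) IM A(1,2), of \<one>] A(3) by auto
  then have "t = \<zero>" using assms(3) unfolding faithful_module_def by blast
  then show False using \<open>t \<in> carrier R - I\<close> by simp
qed

section \<open>Prime submodules over maximal ideals\<close>

text \<open>The colon ideal and, for \<open>m\<close> outside \<open>N\<close>, the ideal of all
  \<open>r\<close> that send \<open>m\<close> into \<open>N\<close> are both proper and contain
  \<open>I\<close>. By maximality both equal \<open>I\<close>, hence each other, which is
  primeness.\<close>

lemma prime_submodule_over_maximalideal:
  assumes "maximalideal I R" and N: "submodule N R M" and ne: "N \<noteq> carrier M"
    and le: "I \<subseteq> colon R M N"
  shows "prime_submodule R M N" and "colon R M N = I"
proof -
  interpret maximalideal I R by fact
  show eq: "colon R M N = I"
    using eq_if_subset_proper[OF ideal_colon[OF N] le] one_notin_colon[OF N ne] .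
  show "prime_submodule R M N"
    unfolding prime_submodule_def
  proof (intro conjI ballI impI)
    fix r m assume r: "r \<in> carrier R" and m: "m \<in> carrier M" and rm: "r \<odot>\<^bsub>M\<^esub> m \<in> N"
    let ?J = "{r \<in> carrier R. \<forall>x\<in>{m}. r \<odot>\<^bsub>M\<^esub> x \<in> N}"
    show "m \<in> N \<or> r \<in> colon R M N"
    proof (cases "m \<in> N")
      case False
      have "?J = I"
      proof (rule eq_if_subset_proper)
        show "ideal ?J R" using ideal_transporter[OF N, of "{m}"] m by simp
        show "I \<subseteq> ?J" using le m by (auto simp: colon_def)
        show "\<one> \<notin> ?J" using False m by simp
      qed
      then show ?thesis using r rm eq by blast
    qed simp
  qed (use N ne in auto)
qed

lemma exists_prime_submodule_over_maximalideal:
  assumes I: "maximalideal I R"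
    and "finitely_generated_module R M" and "faithful_module R M"
  obtains P where "P \<in> mod_Spec R M" and "colon R M P = I"
proof -
  interpret maximalideal I R by fact
  let ?N = "prod_span R M I (carrier M)"
  have N: "submodule ?N R M" by (rule submodule_prod_span[OF is_ideal subset_refl])
  have "primeideal I R" using R.maximalideal_prime[OF I] .
  then have ne: "?N \<noteq> carrier M" using prod_span_primeideal_neq_carrier assms(2,3) by blast
  have "I \<subseteq> colon R M ?N"
    using prod_span_base[OF _ _ a_subset subset_refl] a_subset by (auto simp: colon_def)
  then show thesis
    using prime_submodule_over_maximalideal[OF I N ne] that by (auto simp: mod_Spec_def)
qed

lemma exists_maximalideal_above_colon:
  assumes "P \<in> mod_Spec R M"
  obtains I where "maximalideal I R" and "colon R M P \<subseteq> I"
proof -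
  have P: "submodule P R M" "P \<noteq> carrier M"
    using assms by (auto simp: mod_Spec_def prime_submodule_def)
  show thesis
    using R.exists_maximalideal_above[OF ideal_colon[OF P(1)] one_notin_colon[OF P]] that .
qed

section \<open>Open sets and the Lindelof property\<close>

text \<open>A smaller colon ideal meets fewer multiplicatively closed sets, so shrinking it cannot
  lead from an open set into its closed complement.\<close>

lemma openin_Spec_tilde_colon_subset:
  assumes "openin (Spec_tilde R M) U" and "P \<in> U" and "Q \<in> mod_Spec R M"
    and "colon R M Q \<subseteq> colon R M P"
  shows "Q \<in> U"
proof -
  obtain \<S> where U: "U \<subseteq> mod_Spec R M" "mod_Spec R M - U = V_tilde R M \<S>"
    using assms(1) unfolding openin_Spec_tilde[OF module_axioms] by blast
  then have "P \<in> mod_Spec R M" "P \<notin> V_tilde R M \<S>" using assms(2) by blast+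
  then have "Q \<notin> V_tilde R M \<S>" using assms(4) by (auto simp: V_tilde_def)
  then show ?thesis using U assms(3) by blast
qed

lemma openin_Spec_tilde_below_primeideal:
  assumes "primeideal I R"
  shows "openin (Spec_tilde R M) {Q \<in> mod_Spec R M. colon R M Q \<subseteq> I}"
proof -
  \<comment> \<open>One multiplicatively closed set suffices: a colon ideal meets the complement of
    \<open>I\<close> exactly if it is not contained in \<open>I\<close>.\<close>
  have "mod_Spec R M - {Q \<in> mod_Spec R M. colon R M Q \<subseteq> I} = V_tilde R M {carrier R - I}"
    by (auto simp: V_tilde_def colon_def)
  then show ?thesis
    unfolding openin_Spec_tilde[OF module_axioms]
    using primeideal.submonoid_compl[OF assms] by blast
qed

lemma countable_maximalideal_if_Lindelof:
  assumes "finitely_generated_module R M" and "faithful_module R M"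
    and "Lindelof_space (Spec_tilde R M)"
  shows "countable {I. maximalideal I R}"
proof -
  \<comment> \<open>For maximal \<open>I\<close>, \<open>D I\<close> is the smallest neighbourhood
    of every point with colon ideal \<open>I\<close>.\<close>
  define D where "D I = {Q \<in> mod_Spec R M. colon R M Q \<subseteq> I}" for I
  have "Q \<in> \<Union>(D ` {I. maximalideal I R})" if Q: "Q \<in> mod_Spec R M" for Q
  proof -
    obtain I where "maximalideal I R" "colon R M Q \<subseteq> I"
      using exists_maximalideal_above_colon[OF Q] .
    then show ?thesis using Q by (auto simp: D_def)
  qed
  then have "\<Union>(D ` {I. maximalideal I R}) = topspace (Spec_tilde R M)"
    unfolding topspace_Spec_tilde[OF module_axioms] by (auto simp: D_def)
  moreover have "openin (Spec_tilde R M) (D I)" if "maximalideal I R" for I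
    using openin_Spec_tilde_below_primeideal[OF R.maximalideal_prime[OF that]] by (simp add: D_def)
  ultimately obtain \<V> where \<V>: "countable \<V>" "\<V> \<subseteq> D ` {I. maximalideal I R}"
    "\<Union>\<V> = topspace (Spec_tilde R M)"
    using Lindelof_spaceD[OF assms(3), of "D ` {I. maximalideal I R}"] by blast
  \<comment> \<open>Choosing countably many indices for the subcover avoids a separate proof that
    \<open>D\<close> is injective.\<close>
  from iffD1[OF countable_subset_image conjI[OF \<V>(1,2)]]
  obtain \<C> where \<C>: "countable \<C>" "\<C> \<subseteq> {I. maximalideal I R}" "\<V> = D ` \<C>"
    by (elim exE conjE)
  \<comment> \<open>A point over \<open>I\<close> is covered by some \<open>D K\<close> with
    \<open>K\<close> in \<open>\<C>\<close>. Then \<open>I\<close> is contained in \<open>K\<close>,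
    and maximality gives \<open>K = I\<close>.\<close>
  have "I \<in> \<C>" if I: "maximalideal I R" for I
  proof -
    obtain P where P: "P \<in> mod_Spec R M" "colon R M P = I"
      using exists_prime_submodule_over_maximalideal[OF I assms(1,2)] .
    then have "P \<in> \<Union>(D ` \<C>)" using \<V>(3) \<C>(3) topspace_Spec_tilde[OF module_axioms] by simp
    then obtain K where K: "K \<in> \<C>" "I \<subseteq> K" using P by (auto simp: D_def)
    then have mK: "maximalideal K R" using \<C>(2) by blast
    interpret K: maximalideal K R by fact
    have "\<one> \<notin> K" using K.I_notcarr K.one_imp_carrier by blast
    then have "K = I" using maximalideal.eq_if_subset_proper[OF I K.is_ideal K(2)] by blast
    then show ?thesis using K(1) by simp
  qed
  then show ?thesis using \<C>(1) by (auto intro: countable_subset)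
qed

text \<open>For each maximal ideal pick one member of the cover that contains a point over it. Any
  \<open>Q\<close> has its colon ideal inside some maximal \<open>I\<close>, so it lies in the
  member picked for \<open>I\<close>.\<close>

lemma Lindelof_if_countable_maximalideal:
  assumes "finitely_generated_module R M" and "faithful_module R M"
    and "countable {I. maximalideal I R}"
  shows "Lindelof_space (Spec_tilde R M)"
  unfolding Lindelof_space_alt topspace_Spec_tilde[OF module_axioms]
proof (intro allI impI)
  fix \<U> assume \<U>: "(\<forall>U\<in>\<U>. openin (Spec_tilde R M) U) \<and> mod_Spec R M \<subseteq> \<Union>\<U>"
  have "\<exists>U\<in>\<U>. \<exists>P\<in>U. colon R M P = I" if I: "maximalideal I R" for I
  proof -
    obtain P where "P \<in> mod_Spec R M" "colon R M P = I"
      using exists_prime_submodule_over_maximalideal[OF I assms(1,2)] .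
    then show ?thesis using \<U> by blast
  qed
  then obtain f where f: "\<And>I. maximalideal I R \<Longrightarrow> f I \<in> \<U> \<and> (\<exists>P\<in>f I. colon R M P = I)"
    by metis
  have "Q \<in> \<Union>(f ` {I. maximalideal I R})" if Q: "Q \<in> mod_Spec R M" for Q
  proof -
    obtain I where I: "maximalideal I R" "colon R M Q \<subseteq> I"
      using exists_maximalideal_above_colon[OF Q] .
    obtain P where P: "P \<in> f I" "colon R M P = I" using f[OF I(1)] by blast
    have "Q \<in> f I"
      using openin_Spec_tilde_colon_subset[OF _ P(1) Q] f[OF I(1)] \<U> I(2) P(2) by blast
    then show ?thesis using I(1) by blast
  qed
  then show "\<exists>\<V>. countable \<V> \<and> \<V> \<subseteq> \<U> \<and> mod_Spec R M \<subseteq> \<Union>\<V>"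
    using f assms(3) by (intro exI[of _ "f ` {I. maximalideal I R}"]) auto
qed

end

theorem theorem15:
  fixes R :: "('a, 'm) ring_scheme" and M :: "('a, 'b, 'n) module_scheme"
  assumes "Module.module R M"
    and "finitely_generated_module R M"
    and "faithful_module R M"
    and "mod_Spec R M \<noteq> {}"
  shows "Lindelof_space (Spec_tilde R M) \<longleftrightarrow> countable {I. maximalideal I R}"
  using module.countable_maximalideal_if_Lindelof[OF assms(1-3)]
    module.Lindelof_if_countable_maximalideal[OF assms(1-3)] by blast

end
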